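(* Let $\varphi_A$ be an invertible monomial transformation of $\mathbb{P}^n$. Given a homogeneous polynomial $f\in\mathbb{C}[x_0,\dots,x_n]$ of degree at least $1$, we have $$\deg T_{\varphi_A^*(f)}=\deg T_f.$$ In particular, for the polynomial $g_A=\varphi_A^*(x_0+\cdots+x_n)$, which is the sum of the monomials defining $\varphi_A$, the toric polar map $T_{g_A}\colon\mathbb{P}^n\dashrightarrow\mathbb{P}^n$ is birational.
   Context: Let $A=(a_{ij})_{i,j=0,\dots,n}$ be a matrix of non-negative integers such that $\sum_{j=0}^n a_{ij}=k$ for all $i=0,\dots,n$ (for some fixed $k$), and such that the monomials $m_i=x_0^{a_{i0}}\cdots x_n^{a_{in}}$, $i=0,\dots,n$, have no common factor. It defines a rational map $\varphi_A\colon\mathbb{P}^n\dashrightarrow\mathbb{P}^n$ (over $\mathbb{C}$), $(x_0:\cdots:x_n)\mapsto(m_0:\cdots:m_n)$. One calls $\varphi_A$ an invertible monomial transformation if it is birational. For a homogeneous polynomial $f$, $\varphi_A^*(f)=f(m_0,\dots,m_n)$. The toric polar map of a homogeneous polynomial $g$ is $T_g\colon\mathbb{P}^n\dashrightarrow\mathbb{P}^n$, $x\mapsto(x_0g_{x_0}(x):\cdots:x_ng_{x_n}(x))$, where $g_{x_i}=\partial g/\partial x_i$. The degree of a rational map $\mathbb{P}^n\dashrightarrow\mathbb{P}^n$ is the degree of the corresponding function field extension when it is dominant (the number of points of a general fiber) and $0$ otherwise. *)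

theory Defs
  imports
    Complex_Main
    "HOL-Library.Poly_Mapping"
    "HOL-Computational_Algebra.Fraction_Field"
    "HOL-Algebra.Embedded_Algebras"
    "HOL-Algebra.Algebraic_Closure_Type"
begin

text \<open>
  Complex polynomials in the countably many variables \<open>x\<^sub>0, x\<^sub>1, \<dots>\<close>. The ring
  \<open>\<complex>[x\<^sub>0,\<dots>,x\<^sub>n]\<close> is the subring of those polynomials in which only variables of index at
  most \<open>n\<close> occur; \<open>forms n d\<close> is its homogeneous part of degree \<open>d\<close>, including \<open>0\<close>.
\<close>

type_synonym cpoly = "(nat \<Rightarrow>\<^sub>0 nat) \<Rightarrow>\<^sub>0 complex"

definition cvar :: "nat \<Rightarrow> cpoly"
  where "cvar i = Poly_Mapping.single (Poly_Mapping.single i 1) 1"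

definition cconst :: "complex \<Rightarrow> cpoly"
  where "cconst c = Poly_Mapping.single 0 c"

definition forms :: "nat \<Rightarrow> nat \<Rightarrow> cpoly set"
  where "forms n d =
    {p. \<forall>m \<in> Poly_Mapping.keys p. Poly_Mapping.keys m \<subseteq> {..n}
          \<and> (\<Sum>i\<in>Poly_Mapping.keys m. Poly_Mapping.lookup m i) = d}"

text \<open>
  Evaluation of \<open>p\<close> along a homomorphism \<open>h\<close> on coefficients and values \<open>v\<close> for the variables.
\<close>

definition eval_hom :: "(complex \<Rightarrow> 'a::comm_semiring_1) \<Rightarrow> (nat \<Rightarrow> 'a) \<Rightarrow> cpoly \<Rightarrow> 'a"
  where "eval_hom h v p =
    (\<Sum>m\<in>Poly_Mapping.keys p. h (Poly_Mapping.lookup p m)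
        * (\<Prod>i\<in>Poly_Mapping.keys m. v i ^ Poly_Mapping.lookup m i))"

definition eval_at :: "(nat \<Rightarrow> complex) \<Rightarrow> cpoly \<Rightarrow> complex"
  where "eval_at = eval_hom (\<lambda>c. c)"

definition subst :: "(nat \<Rightarrow> cpoly) \<Rightarrow> cpoly \<Rightarrow> cpoly"
  where "subst F = eval_hom cconst F"

definition partial_deriv :: "nat \<Rightarrow> cpoly \<Rightarrow> cpoly"
  where "partial_deriv i p =
    (\<Sum>m\<in>Poly_Mapping.keys p.
       Poly_Mapping.single (m - Poly_Mapping.single i 1)
         (of_nat (Poly_Mapping.lookup m i) * Poly_Mapping.lookup p m))"

text \<open>
  A rational map from \<open>\<P>\<^sup>n\<close> to itself is represented by a tuple \<open>F 0, \<dots>, F n\<close> of forms of the same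
  degree that are not all zero; entries of index above \<open>n\<close> are irrelevant, and the tuple may have a
  common factor. Two representatives define the same rational map iff they are proportional.
\<close>

definition rational_map :: "nat \<Rightarrow> (nat \<Rightarrow> cpoly) \<Rightarrow> bool"
  where "rational_map n F \<longleftrightarrow> (\<exists>d. \<forall>i\<le>n. F i \<in> forms n d) \<and> (\<exists>i\<le>n. F i \<noteq> 0)"

definition same_rational_map :: "nat \<Rightarrow> (nat \<Rightarrow> cpoly) \<Rightarrow> (nat \<Rightarrow> cpoly) \<Rightarrow> bool"
  where "same_rational_map n F G \<longleftrightarrow>
    rational_map n F \<and> rational_map n G \<and> (\<forall>i\<le>n. \<forall>j\<le>n. F i * G j = F j * G i)"

text \<open>
  The composite \<open>G \<circ> F\<close>. It is a \<open>rational_map\<close> exactly when it is not identically zero.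
\<close>

definition compose_map :: "(nat \<Rightarrow> cpoly) \<Rightarrow> (nat \<Rightarrow> cpoly) \<Rightarrow> nat \<Rightarrow> cpoly"
  where "compose_map G F = (\<lambda>i. subst F (G i))"

definition birational :: "nat \<Rightarrow> (nat \<Rightarrow> cpoly) \<Rightarrow> bool"
  where "birational n F \<longleftrightarrow> rational_map n F \<and>
    (\<exists>G. rational_map n G
       \<and> same_rational_map n (compose_map G F) cvar
       \<and> same_rational_map n (compose_map F G) cvar)"

text \<open>
  Points of \<open>\<P>\<^sup>n\<close> are given by homogeneous coordinates \<open>x 0, \<dots>, x n\<close>, not all zero; values
  of \<open>x\<close> above \<open>n\<close> are irrelevant. A map is dominant iff its image is Zariski dense, i.e.
  iff no nonzero form vanishes on the image. A common factor of the tuple only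
  removes a proper closed subset from the domain considered here, which does not affect density.
\<close>

definition proj_point :: "nat \<Rightarrow> (nat \<Rightarrow> complex) \<Rightarrow> bool"
  where "proj_point n x \<longleftrightarrow> (\<exists>i\<le>n. x i \<noteq> 0)"

definition map_at :: "(nat \<Rightarrow> cpoly) \<Rightarrow> (nat \<Rightarrow> complex) \<Rightarrow> nat \<Rightarrow> complex"
  where "map_at F x = (\<lambda>i. eval_at x (F i))"

definition dominant :: "nat \<Rightarrow> (nat \<Rightarrow> cpoly) \<Rightarrow> bool"
  where "dominant n F \<longleftrightarrow>
    (\<forall>e. \<forall>p\<in>forms n e.
       (\<forall>x. proj_point n x \<and> proj_point n (map_at F x) \<longrightarrow> eval_at (map_at F x) p = 0)
       \<longrightarrow> p = 0)"

text \<open>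
  The function field of \<open>\<P>\<^sup>n\<close>, as a subfield of the field of all rational functions, and
  its image under pullback along a dominant \<open>F\<close> (for which \<open>q \<noteq> 0\<close> implies
  \<open>subst F q \<noteq> 0\<close>).
\<close>

definition function_field :: "nat \<Rightarrow> cpoly fract set"
  where "function_field n = {Fract p q | p q d. p \<in> forms n d \<and> q \<in> forms n d \<and> q \<noteq> 0}"

definition pullback_field :: "nat \<Rightarrow> (nat \<Rightarrow> cpoly) \<Rightarrow> cpoly fract set"
  where "pullback_field n F =
    {Fract (subst F p) (subst F q) | p q d. p \<in> forms n d \<and> q \<in> forms n d \<and> q \<noteq> 0}"

definition map_degree :: "nat \<Rightarrow> (nat \<Rightarrow> cpoly) \<Rightarrow> nat"
  where "map_degree n F =
    (if dominant n F
     then ring.dim (ring_of_type_algebra :: cpoly fract ring) (pullback_field n F) (function_field n)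
     else 0)"

definition monomial_map :: "nat \<Rightarrow> (nat \<Rightarrow> nat \<Rightarrow> nat) \<Rightarrow> nat \<Rightarrow> cpoly"
  where "monomial_map n A i = (\<Prod>j\<le>n. cvar j ^ A i j)"

definition toric_polar :: "cpoly \<Rightarrow> nat \<Rightarrow> cpoly"
  where "toric_polar g i = cvar i * partial_deriv i g"

end

(*
  Write theta_j = x_j d/dx_j, so that T_f = (theta_0 f, ..., theta_n f). A monomial x^a is an
  eigenvector of theta_j with eigenvalue a_j, whence theta_j (f o phi_A) = sum_i a_ij (theta_i f) o phi_A,
  i.e. T_{phi_A^* f} = A^T o T_f o phi_A. If phi_A is birational then A is nonsingular: an integer
  vector c in its left kernel yields two monomials x^{c+}, x^{c-} of equal degree with the same
  pullback. So T_{phi_A^* f} arises from T_f by composing with a linear automorphism, which does not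
  change the image of the pullback of function fields, and with a birational map, whose pullback is an
  automorphism of the function field. Neither affects dominance or degree.
  For f = x_0 + ... + x_n, T_f is the identity.
*)
theory Submission
  imports Defs "Jordan_Normal_Form.Determinant"
begin

section \<open>Evaluation and homogeneity\<close>

text \<open>The definitions speak of points and of tuples of forms up to proportionality; two
  reductions make this algebra. Dominance of F is injectivity of \<open>subst F\<close> on forms of
  each degree, because a complex polynomial that vanishes at every point is zero. And a composite H
  that is the identity of projective space satisfies only H_i x_j = H_j x_i; on a form p of degree d
  this becomes x_0^d p(H) = H_0^d p, and the factors cancel in quotients of forms of equal degree.
  The linear map acts on the target and merely permutes the forms to be pulled back, so the smaller
  field stays the same set. The monomial map acts on the source and moves the smaller field inside
  the function field, so dimension must be transported along an automorphism.\<close>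

lemma cpoly_eq_sum_singles:
  "p = (\<Sum>m\<in>Poly_Mapping.keys p. Poly_Mapping.single m (Poly_Mapping.lookup p m))"
  for p :: "'a \<Rightarrow>\<^sub>0 'b::comm_monoid_add"
  by (rule poly_mapping_eqI)
     (auto simp: Poly_Mapping.lookup_sum lookup_single when_def in_keys_iff sum.delta')

text \<open>Partial sums of the expansion into terms stay within the support of p, so the monomial
  case may assume \<open>m \<in> Poly_Mapping.keys p\<close>. \<open>forms_induct\<close> draws its
  degree and index bounds from this.\<close>

lemma poly_mapping_add_induct [case_names zero single add]:
  fixes p :: "'a \<Rightarrow>\<^sub>0 'b::comm_monoid_add"
  assumes "P 0"
    and "\<And>m c. m \<in> Poly_Mapping.keys p \<Longrightarrow> P (Poly_Mapping.single m c)"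
    and "\<And>q r. P q \<Longrightarrow> P r \<Longrightarrow> P (q + r)"
  shows "P p"
proof -
  have "S \<subseteq> Poly_Mapping.keys p \<Longrightarrow>
      P (\<Sum>m\<in>S. Poly_Mapping.single m (Poly_Mapping.lookup p m))" if "finite S" for S
    using that by (induction S) (auto intro: assms)
  from this[OF finite_keys order_refl] show ?thesis
    using cpoly_eq_sum_singles[of p] by simp
qed

definition monom_at :: "(nat \<Rightarrow> 'a::comm_semiring_1) \<Rightarrow> (nat \<Rightarrow>\<^sub>0 nat) \<Rightarrow> 'a"
  where "monom_at v m = (\<Prod>i\<in>Poly_Mapping.keys m. v i ^ Poly_Mapping.lookup m i)"

lemma monom_at_superset:
  assumes "finite S" "Poly_Mapping.keys m \<subseteq> S"
  shows "monom_at v m = (\<Prod>i\<in>S. v i ^ Poly_Mapping.lookup m i)"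
  unfolding monom_at_def using assms
  by (intro prod.mono_neutral_left) (auto simp: in_keys_iff)

lemma monom_at_0 [simp]: "monom_at v 0 = 1"
  by (simp add: monom_at_def)

lemma monom_at_single [simp]: "monom_at v (Poly_Mapping.single i e) = v i ^ e"
  by (simp add: monom_at_def)

lemma monom_at_add: "monom_at v (m + m') = monom_at v m * monom_at v m'"
proof -
  let ?S = "Poly_Mapping.keys m \<union> Poly_Mapping.keys m'"
  have "monom_at v (m + m') = (\<Prod>i\<in>?S. v i ^ Poly_Mapping.lookup (m + m') i)"
    by (intro monom_at_superset) (use keys_add[of m m'] in auto)
  also have "\<dots> = (\<Prod>i\<in>?S. v i ^ Poly_Mapping.lookup m i) * (\<Prod>i\<in>?S. v i ^ Poly_Mapping.lookup m' i)"
    by (simp add: lookup_add power_add prod.distrib)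
  also have "\<dots> = monom_at v m * monom_at v m'"
    by (simp add: monom_at_superset[of ?S])
  finally show ?thesis .
qed

text \<open>One proof for both uses of \<open>eval_hom\<close>: the identity as \<open>h\<close>
  gives evaluation at points, \<open>cconst\<close> gives substitution of polynomials.\<close>

locale coeff_hom =
  fixes h :: "complex \<Rightarrow> 'a::comm_semiring_1"
  assumes h_0 [simp]: "h 0 = 0" and h_1 [simp]: "h 1 = 1"
    and h_add: "h (a + b) = h a + h b" and h_mult: "h (a * b) = h a * h b"
begin

lemma eval_hom_alt: "eval_hom h v p =
    (\<Sum>m\<in>Poly_Mapping.keys p. h (Poly_Mapping.lookup p m) * monom_at v m)"
  by (simp add: eval_hom_def monom_at_def)

lemma eval_hom_0 [simp]: "eval_hom h v 0 = 0"
  by (simp add: eval_hom_alt)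

lemma eval_hom_single [simp]: "eval_hom h v (Poly_Mapping.single m c) = h c * monom_at v m"
  by (simp add: eval_hom_alt)

lemma eval_hom_add: "eval_hom h v (p + q) = eval_hom h v p + eval_hom h v q"
  unfolding eval_hom_alt
  by (rule setsum_keys_plus_distrib) (auto simp: h_add distrib_right)

lemma eval_hom_1 [simp]: "eval_hom h v 1 = 1"
  using eval_hom_single[of v 0 1] by simp

lemma eval_hom_mult: "eval_hom h v (p * q) = eval_hom h v p * eval_hom h v q"
proof (induction p rule: poly_mapping_add_induct)
  case (single m c)
  show ?case
  proof (induction q rule: poly_mapping_add_induct)
    case (single m' c')
    show ?case by (simp add: mult_single monom_at_add h_mult mult_ac)
  qed (simp_all add: distrib_left eval_hom_add)
qed (simp_all add: eval_hom_add distrib_right)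

lemma eval_hom_sum: "eval_hom h v (sum F S) = (\<Sum>i\<in>S. eval_hom h v (F i))"
  by (induction S rule: infinite_finite_induct) (auto simp: eval_hom_add)

lemma eval_hom_prod: "eval_hom h v (prod F S) = (\<Prod>i\<in>S. eval_hom h v (F i))"
  by (induction S rule: infinite_finite_induct) (auto simp: eval_hom_mult)

lemma eval_hom_power: "eval_hom h v (p ^ e) = eval_hom h v p ^ e"
  by (induction e) (auto simp: eval_hom_mult)

lemma eval_hom_cvar [simp]: "eval_hom h v (cvar i) = v i"
  by (simp add: cvar_def)

lemma eval_hom_cconst [simp]: "eval_hom h v (cconst c) = h c"
  by (simp add: cconst_def)

end

lemma cconst_0 [simp]: "cconst 0 = 0" and cconst_1 [simp]: "cconst 1 = 1"
  and cconst_add: "cconst (a + b) = cconst a + cconst b"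
  and cconst_mult: "cconst (a * b) = cconst a * cconst b"
  by (simp_all add: cconst_def single_add mult_single)

lemma coeff_hom_cconst: "coeff_hom cconst"
  by (rule coeff_hom.intro) (simp_all add: cconst_add cconst_mult)

lemma coeff_hom_id: "coeff_hom (\<lambda>c. c)"
  by (rule coeff_hom.intro) simp_all

lemmas subst_0 [simp] = coeff_hom.eval_hom_0[OF coeff_hom_cconst, folded subst_def]
lemmas subst_single [simp] = coeff_hom.eval_hom_single[OF coeff_hom_cconst, folded subst_def]
lemmas subst_add = coeff_hom.eval_hom_add[OF coeff_hom_cconst, folded subst_def]
lemmas subst_1 [simp] = coeff_hom.eval_hom_1[OF coeff_hom_cconst, folded subst_def]
lemmas subst_mult = coeff_hom.eval_hom_mult[OF coeff_hom_cconst, folded subst_def]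
lemmas subst_sum = coeff_hom.eval_hom_sum[OF coeff_hom_cconst, folded subst_def]
lemmas subst_prod = coeff_hom.eval_hom_prod[OF coeff_hom_cconst, folded subst_def]
lemmas subst_power = coeff_hom.eval_hom_power[OF coeff_hom_cconst, folded subst_def]
lemmas subst_var [simp] = coeff_hom.eval_hom_cvar[OF coeff_hom_cconst, folded subst_def]
lemmas subst_const [simp] = coeff_hom.eval_hom_cconst[OF coeff_hom_cconst, folded subst_def]

lemmas eval_at_0 [simp] = coeff_hom.eval_hom_0[OF coeff_hom_id, folded eval_at_def]
lemmas eval_at_single [simp] = coeff_hom.eval_hom_single[OF coeff_hom_id, folded eval_at_def]
lemmas eval_at_add = coeff_hom.eval_hom_add[OF coeff_hom_id, folded eval_at_def]
lemmas eval_at_mult = coeff_hom.eval_hom_mult[OF coeff_hom_id, folded eval_at_def]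
lemmas eval_at_prod = coeff_hom.eval_hom_prod[OF coeff_hom_id, folded eval_at_def]
lemmas eval_at_power = coeff_hom.eval_hom_power[OF coeff_hom_id, folded eval_at_def]
lemmas eval_at_var [simp] = coeff_hom.eval_hom_cvar[OF coeff_hom_id, folded eval_at_def]
lemmas eval_at_const [simp] = coeff_hom.eval_hom_cconst[OF coeff_hom_id, folded eval_at_def]

lemmas subst_simps = subst_add subst_mult subst_sum subst_prod subst_power

lemma cconst_of_nat: "cconst (of_nat k) = of_nat k"
  by (simp add: cconst_def)

lemma cconst_sum: "cconst (sum a S) = (\<Sum>i\<in>S. cconst (a i))"
  by (induction S rule: infinite_finite_induct) (auto simp: cconst_add)

lemma subst_diff: "subst F (p - q) = subst F p - subst F q"
  using subst_add[of F "p - q" q] by (simp add: algebra_simps)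

lemma subst_monom_at: "subst F (monom_at G m) = monom_at (\<lambda>i. subst F (G i)) m"
  by (simp only: monom_at_def subst_simps)

lemma subst_subst: "subst F (subst G p) = subst (\<lambda>i. subst F (G i)) p"
proof (induction p rule: poly_mapping_add_induct)
  case (single m c)
  show ?case by (simp add: subst_mult subst_monom_at)
qed (simp_all add: subst_add)

lemma eval_at_subst: "eval_at x (subst F p) = eval_at (\<lambda>i. eval_at x (F i)) p"
proof (induction p rule: poly_mapping_add_induct)
  case (single m c)
  show ?case
    by (simp add: eval_at_mult eval_at_prod eval_at_power monom_at_def)
qed (simp_all add: subst_add eval_at_add)

lemma monom_at_cvar: "monom_at cvar m = Poly_Mapping.single m 1"
proof (induction m rule: poly_mapping_add_induct)
  case (single i e)
  have "cvar i ^ e = Poly_Mapping.single (Poly_Mapping.single i e) 1"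
    by (induction e) (simp_all add: cvar_def mult_single flip: single_add)
  then show ?case by simp
qed (simp_all add: monom_at_add mult_single)

lemma subst_id [simp]: "subst cvar p = p"
proof (induction p rule: poly_mapping_add_induct)
  case (single m c)
  show ?case by (simp add: monom_at_cvar cconst_def mult_single)
qed (simp_all add: subst_add)

lemma cvar_neq_0 [simp]: "cvar i \<noteq> 0"
  by (simp add: cvar_def flip: keys_eq_empty)

section \<open>Total degree and homogeneous forms\<close>

definition total_deg :: "(nat \<Rightarrow>\<^sub>0 nat) \<Rightarrow> nat"
  where "total_deg m = (\<Sum>i\<in>Poly_Mapping.keys m. Poly_Mapping.lookup m i)"

lemma total_deg_superset:
  assumes "finite S" "Poly_Mapping.keys m \<subseteq> S"
  shows "total_deg m = (\<Sum>i\<in>S. Poly_Mapping.lookup m i)"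
  unfolding total_deg_def using assms
  by (intro sum.mono_neutral_left) (auto simp: in_keys_iff)

lemma total_deg_add: "total_deg (m + m') = total_deg m + total_deg m'"
proof -
  let ?S = "Poly_Mapping.keys m \<union> Poly_Mapping.keys m'"
  have "total_deg (m + m') = (\<Sum>i\<in>?S. Poly_Mapping.lookup (m + m') i)"
    by (intro total_deg_superset) (use keys_add[of m m'] in auto)
  also have "\<dots> = total_deg m + total_deg m'"
    by (simp add: total_deg_superset[of ?S] lookup_add sum.distrib)
  finally show ?thesis .
qed

lemma forms_iff: "p \<in> forms n d \<longleftrightarrow>
    (\<forall>m\<in>Poly_Mapping.keys p. Poly_Mapping.keys m \<subseteq> {..n} \<and> total_deg m = d)"
  by (simp add: forms_def total_deg_def)

lemma forms_0 [simp]: "0 \<in> forms n d"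
  by (simp add: forms_iff)

lemma forms_1 [simp]: "1 \<in> forms n 0"
  by (simp add: forms_iff total_deg_def)

lemma forms_cconst [simp]: "cconst c \<in> forms n 0"
  by (simp add: forms_iff total_deg_def cconst_def)

lemma forms_cvar [simp]: "i \<le> n \<Longrightarrow> cvar i \<in> forms n 1"
  by (simp add: forms_iff total_deg_def cvar_def)

lemma forms_add: "p \<in> forms n d \<Longrightarrow> q \<in> forms n d \<Longrightarrow> p + q \<in> forms n d"
  using keys_add[of p q] by (auto simp: forms_iff subset_iff)

lemma forms_diff: "p \<in> forms n d \<Longrightarrow> q \<in> forms n d \<Longrightarrow> p - q \<in> forms n d"
  using keys_diff[of p q] by (auto simp: forms_iff subset_iff)

lemma forms_mult:
  assumes "p \<in> forms n d" "q \<in> forms n e"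
  shows "p * q \<in> forms n (d + e)"
  unfolding forms_iff
proof
  fix m assume "m \<in> Poly_Mapping.keys (p * q)"
  then obtain a b where "m = a + b" "a \<in> Poly_Mapping.keys p" "b \<in> Poly_Mapping.keys q"
    using keys_mult[of p q] by blast
  moreover from this assms have "Poly_Mapping.keys a \<subseteq> {..n}" "Poly_Mapping.keys b \<subseteq> {..n}"
      "total_deg a = d" "total_deg b = e"
    by (simp_all add: forms_iff)
  ultimately show "Poly_Mapping.keys m \<subseteq> {..n} \<and> total_deg m = d + e"
    using keys_add[of a b] by (auto simp: total_deg_add)
qed

lemma forms_mult': "p \<in> forms n d \<Longrightarrow> q \<in> forms n e \<Longrightarrow> p * q \<in> forms n (e + d)"
  using forms_mult[of p n d q e] by (simp add: add.commute)

lemma forms_sum: "(\<And>i. i \<in> S \<Longrightarrow> F i \<in> forms n d) \<Longrightarrow> sum F S \<in> forms n d"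
  by (induction S rule: infinite_finite_induct) (auto intro: forms_add)

lemma forms_power: "p \<in> forms n d \<Longrightarrow> p ^ e \<in> forms n (d * e)"
  by (induction e) (simp_all add: forms_mult)

lemma forms_prod:
  "(\<And>i. i \<in> S \<Longrightarrow> F i \<in> forms n (d i)) \<Longrightarrow> prod F S \<in> forms n (sum d S)"
  by (induction S rule: infinite_finite_induct) (auto intro: forms_mult)

lemma forms_induct [consumes 1, case_names zero single add]:
  assumes "p \<in> forms n d" and "P 0"
    and "\<And>m c. Poly_Mapping.keys m \<subseteq> {..n} \<Longrightarrow> total_deg m = d \<Longrightarrow> P (Poly_Mapping.single m c)"
    and "\<And>q r. P q \<Longrightarrow> P r \<Longrightarrow> P (q + r)"
  shows "P p"
proof (induction p rule: poly_mapping_add_induct)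
  case (single m c)
  with assms(1) show ?case by (intro assms(3)) (auto simp: forms_iff)
qed (use assms(2,4) in blast)+

lemma forms_monom_at:
  assumes "\<And>i. i \<le> n \<Longrightarrow> F i \<in> forms n e" "Poly_Mapping.keys m \<subseteq> {..n}"
  shows "monom_at F m \<in> forms n (e * total_deg m)"
  unfolding monom_at_def total_deg_def sum_distrib_left
  by (intro forms_prod forms_power assms) (use assms(2) in auto)

lemma forms_subst:
  assumes "p \<in> forms n d" "\<And>i. i \<le> n \<Longrightarrow> F i \<in> forms n e"
  shows "subst F p \<in> forms n (e * d)"
  using assms(1)
proof (induction rule: forms_induct)
  case (single m c)
  then show ?case
    using forms_mult[OF forms_cconst forms_monom_at[OF assms(2) single(1)]] by simp
qed (simp_all add: subst_simps forms_add)

lemma monom_at_cong: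
  assumes "\<And>i. i \<le> n \<Longrightarrow> F i = G i" "Poly_Mapping.keys m \<subseteq> {..n}"
  shows "monom_at F m = monom_at G m"
  unfolding monom_at_def using assms by (intro prod.cong) auto

lemma subst_cong:
  assumes "p \<in> forms n d" and eq: "\<And>i. i \<le> n \<Longrightarrow> F i = G i"
  shows "subst F p = subst G p"
  using assms(1)
proof (induction rule: forms_induct)
  case (single m c)
  show ?case using monom_at_cong[OF eq single(1)] by simp
qed (simp_all add: subst_simps)

lemma monom_at_scale:
  "monom_at (\<lambda>i. s * F i) m = s ^ total_deg m * monom_at F m"
  by (simp add: monom_at_def total_deg_def power_mult_distrib prod.distrib power_sum)

text \<open>Each term collects \<open>s\<close> once per variable factor, hence d times. The factor
  is itself a polynomial, as comparing proportional tuples requires.\<close>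

lemma subst_scale:
  assumes "p \<in> forms n d"
  shows "subst (\<lambda>i. s * F i) p = s ^ d * subst F p"
  using assms
  by (induction rule: forms_induct) (simp_all add: subst_simps monom_at_scale algebra_simps)

section \<open>The logarithmic derivations\<close>

lemma toric_polar_alt: "toric_polar p j =
    (\<Sum>m\<in>Poly_Mapping.keys p.
       Poly_Mapping.single m (of_nat (Poly_Mapping.lookup m j) * Poly_Mapping.lookup p m))"
proof -
  have "cvar j * Poly_Mapping.single (m - Poly_Mapping.single j 1) (of_nat (Poly_Mapping.lookup m j) * c)
      = Poly_Mapping.single m (of_nat (Poly_Mapping.lookup m j) * c)" for m c
  \<comment> \<open>At exponent 0 the truncated subtraction fails to lower the exponent, but then
    the coefficient is 0.\<close>
  proof (cases "Poly_Mapping.lookup m j = 0")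
    case False
    then have "Poly_Mapping.single j 1 + (m - Poly_Mapping.single j 1) = m"
      by (intro poly_mapping_eqI) (auto simp: lookup_add lookup_minus lookup_single when_def)
    then show ?thesis by (simp add: cvar_def mult_single)
  qed simp
  then show ?thesis
    by (simp add: toric_polar_def partial_deriv_def sum_distrib_left)
qed

lemma toric_polar_single [simp]:
  "toric_polar (Poly_Mapping.single m c) j = Poly_Mapping.single m (of_nat (Poly_Mapping.lookup m j) * c)"
  by (simp add: toric_polar_alt)

lemma toric_polar_0 [simp]: "toric_polar 0 j = 0"
  by (simp add: toric_polar_alt)

lemma toric_polar_add: "toric_polar (p + q) j = toric_polar p j + toric_polar q j"
  unfolding toric_polar_alt
  by (rule setsum_keys_plus_distrib) (simp_all add: distrib_left single_add)

lemma toric_polar_mult: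
  "toric_polar (p * q) j = toric_polar p j * q + p * toric_polar q j"
proof (induction p rule: poly_mapping_add_induct)
  case (single m c)
  show ?case
  proof (induction q rule: poly_mapping_add_induct)
    case (single m' c')
    show ?case by (simp add: mult_single lookup_add algebra_simps single_add)
  qed (simp_all add: toric_polar_add algebra_simps)
qed (simp_all add: toric_polar_add algebra_simps)

lemma toric_polar_cconst [simp]: "toric_polar (cconst c) j = 0"
  by (simp add: cconst_def)

lemma toric_polar_cvar: "toric_polar (cvar i) j = (if i = j then cvar i else 0)"
  by (simp add: cvar_def lookup_single)

lemma forms_toric_polar: "p \<in> forms n d \<Longrightarrow> toric_polar p j \<in> forms n d"
  unfolding toric_polar_alt by (intro forms_sum) (auto simp: forms_iff)

lemma toric_polar_1 [simp]: "toric_polar 1 j = 0"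
  using toric_polar_cconst[of 1] by simp

text \<open>By the Leibniz rule eigenvalues behave like logarithms: a power multiplies them by e,
  and a product, below, adds them.\<close>

lemma toric_polar_power_eigen:
  assumes "toric_polar p j = of_nat a * p"
  shows "toric_polar (p ^ e) j = of_nat (e * a) * p ^ e"
  by (induction e) (simp_all add: toric_polar_mult assms algebra_simps)

lemma toric_polar_prod_eigen:
  assumes "\<And>i. i \<in> S \<Longrightarrow> toric_polar (F i) j = of_nat (a i) * F i"
  shows "toric_polar (prod F S) j = of_nat (sum a S) * prod F S"
  using assms
  by (induction S rule: infinite_finite_induct) (simp_all add: toric_polar_mult algebra_simps)

lemma toric_polar_monom_at_eigen:
  assumes "\<And>i. i \<in> Poly_Mapping.keys m \<Longrightarrow> toric_polar (F i) j = of_nat (a i) * F i"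
  shows "toric_polar (monom_at F m) j =
    of_nat (\<Sum>i\<in>Poly_Mapping.keys m. Poly_Mapping.lookup m i * a i) * monom_at F m"
  unfolding monom_at_def by (intro toric_polar_prod_eigen toric_polar_power_eigen assms)

lemma toric_polar_cvar_powers:
  assumes "j \<le> n"
  shows "toric_polar (\<Prod>i\<le>n. cvar i ^ a i) j = of_nat (a j) * (\<Prod>i\<le>n. cvar i ^ a i)"
proof -
  have "toric_polar (\<Prod>i\<le>n. cvar i ^ a i) j =
      of_nat (\<Sum>i\<le>n. a i * (if i = j then 1 else 0)) * (\<Prod>i\<le>n. cvar i ^ a i)"
    by (intro toric_polar_prod_eigen toric_polar_power_eigen) (simp add: toric_polar_cvar)
  also have "(\<Sum>i\<le>n. a i * (if i = j then 1 else 0)) = (\<Sum>i\<le>n. if i = j then a i else 0)"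
    by (intro sum.cong) auto
  also have "\<dots> = a j"
    using assms by simp
  finally show ?thesis .
qed

text \<open>Exponents are recovered as eigenvalues: cancelling the nonzero monomial leaves an
  equality of natural numbers inside a ring of characteristic zero.\<close>

lemma cvar_powers_inj:
  assumes "(\<Prod>i\<le>n. cvar i ^ a i) = (\<Prod>i\<le>n. cvar i ^ b i)" "j \<le> n"
  shows "a j = b j"
proof -
  let ?P = "\<Prod>i\<le>n. cvar i ^ a i"
  have "of_nat (a j) * ?P = of_nat (b j) * ?P"
    using toric_polar_cvar_powers[of j n a] toric_polar_cvar_powers[of j n b] assms by simp
  then have "(of_nat (a j) :: cpoly) = of_nat (b j)"
    by (simp add: mult_cancel_right)
  then have "Poly_Mapping.lookup (of_nat (a j) :: cpoly) 0 = Poly_Mapping.lookup (of_nat (b j) :: cpoly) 0"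
    by simp
  then show ?thesis
    by (simp add: lookup_of_nat)
qed

lemma toric_polar_monomial_map:
  "j \<le> n \<Longrightarrow> toric_polar (monomial_map n A i) j = of_nat (A i j) * monomial_map n A i"
  unfolding monomial_map_def by (rule toric_polar_cvar_powers)

text \<open>Both sides are additive in f, so a single term c x^m suffices. Its pullback has
  eigenvalue sum_i m_i a_ij, where m_i is in turn the eigenvalue of x^m under x_i d/dx_i.\<close>

lemma toric_polar_subst_monomial_map:
  assumes "f \<in> forms n d" "j \<le> n"
  shows "toric_polar (subst (monomial_map n A) f) j =
    (\<Sum>i\<le>n. of_nat (A i j) * subst (monomial_map n A) (toric_polar f i))"
  using assms(1)
proof (induction rule: forms_induct)
  case (single m c)
  let ?M = "monom_at (monomial_map n A) m"
  have "toric_polar (subst (monomial_map n A) (Poly_Mapping.single m c)) j =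
      cconst c * (of_nat (\<Sum>i\<in>Poly_Mapping.keys m. Poly_Mapping.lookup m i * A i j) * ?M)"
    by (simp add: toric_polar_mult toric_polar_monom_at_eigen[OF toric_polar_monomial_map[OF assms(2)]])
  also have "(\<Sum>i\<in>Poly_Mapping.keys m. Poly_Mapping.lookup m i * A i j)
      = (\<Sum>i\<le>n. Poly_Mapping.lookup m i * A i j)"
    using single(1) by (intro sum.mono_neutral_left) (auto simp: in_keys_iff)
  also have "cconst c * (of_nat (\<Sum>i\<le>n. Poly_Mapping.lookup m i * A i j) * ?M)
      = (\<Sum>i\<le>n. of_nat (A i j) * (of_nat (Poly_Mapping.lookup m i) * cconst c * ?M))"
    by (simp add: sum_distrib_left sum_distrib_right mult_ac)
  also have "\<dots> = (\<Sum>i\<le>n. of_nat (A i j) *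
      subst (monomial_map n A) (toric_polar (Poly_Mapping.single m c) i))"
    by (simp add: cconst_mult cconst_of_nat)
  finally show ?case .
qed (simp_all add: toric_polar_add subst_add distrib_left sum.distrib)

section \<open>Dominance, and monomial maps of full rank\<close>

text \<open>Reduction modulo N isolates the lowest digit; removing it and dividing by N leaves a
  shorter expansion.\<close>

lemma digits_unique:
  fixes a b :: "nat \<Rightarrow> nat"
  assumes "(\<Sum>i<M. a i * N ^ i) = (\<Sum>i<M. b i * N ^ i)"
    and "\<And>i. a i < N" "\<And>i. b i < N" "i < M"
  shows "a i = b i"
  using assms
proof (induction M arbitrary: a b i)
  case (Suc M)
  have split: "(\<Sum>i<Suc M. c i * N ^ i) = c 0 + N * (\<Sum>i<M. c (Suc i) * N ^ i)" for c :: "nat \<Rightarrow> nat"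
    by (simp add: sum.lessThan_Suc_shift sum_distrib_left mult_ac del: sum.lessThan_Suc)
  from Suc.prems(1) have eq: "a 0 + N * (\<Sum>i<M. a (Suc i) * N ^ i) = b 0 + N * (\<Sum>i<M. b (Suc i) * N ^ i)"
    by (simp only: split)
  have 0: "a 0 = b 0"
    using arg_cong[OF eq, of "\<lambda>x. x mod N"] Suc.prems(2,3) by simp
  moreover have "N > 0"
    using Suc.prems(2)[of 0] by simp
  ultimately have "(\<Sum>i<M. a (Suc i) * N ^ i) = (\<Sum>i<M. b (Suc i) * N ^ i)"
    using eq by simp
  then have "a (Suc j) = b (Suc j)" if "j < M" for j
    using Suc.IH[of "\<lambda>i. a (Suc i)" "\<lambda>i. b (Suc i)" j] Suc.prems(2,3) that by simp
  with 0 Suc.prems(4) show ?case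
    by (cases i) auto
qed simp

text \<open>Kronecker substitution \<open>x\<^sub>i = t ^ (N ^ i)\<close> separates the monomials of \<open>p\<close>.\<close>
lemma eval_at_eq_0_imp_eq_0:
  assumes "\<And>x. eval_at x p = 0"
  shows "p = 0"
proof -
  let ?K = "Poly_Mapping.keys p"
  define V where "V = (\<Union>m\<in>?K. Poly_Mapping.keys m)"
  have "finite V" by (simp add: V_def)
  then obtain M where M: "V \<subseteq> {..<M}"
    using finite_nat_iff_bounded by blast
  define E where "E = (\<Union>m\<in>?K. Poly_Mapping.lookup m ` V)"
  \<comment> \<open>The inserted 0 forces N > 0, which bounds the zero exponents of variables
    outside \<open>V\<close> as well.\<close>
  have "finite (insert 0 E)" using \<open>finite V\<close> by (simp add: E_def)
  then obtain N where N: "insert 0 E \<subseteq> {..<N}"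
    using finite_nat_iff_bounded by blast
  have bound: "Poly_Mapping.lookup m i < N" if "m \<in> ?K" for m i
  proof (cases "i \<in> V")
    case True
    with that N show ?thesis by (auto simp: E_def)
  next
    case False
    with that have "Poly_Mapping.lookup m i = 0" by (auto simp: V_def in_keys_iff)
    with N show ?thesis by simp
  qed
  have vars: "Poly_Mapping.keys m \<subseteq> {..<M}" if "m \<in> ?K" for m
    using that M by (auto simp: V_def)
  define w where "w m = (\<Sum>i<M. Poly_Mapping.lookup m i * N ^ i)" for m
  have inj: "inj_on w ?K"
  proof
    fix m m' assume m: "m \<in> ?K" and m': "m' \<in> ?K" and eq: "w m = w m'"
    show "m = m'"
    proof (rule poly_mapping_eqI)
      fix i
      show "Poly_Mapping.lookup m i = Poly_Mapping.lookup m' i"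
      proof (cases "i < M")
        case True
        with eq show ?thesis
          unfolding w_def by (intro digits_unique[OF _ bound[OF m] bound[OF m']])
      next
        case False
        with vars[OF m] vars[OF m'] have "i \<notin> Poly_Mapping.keys m" "i \<notin> Poly_Mapping.keys m'"
          by auto
        then show ?thesis by (simp add: in_keys_iff)
      qed
    qed
  qed
  define P where "P = (\<Sum>m\<in>?K. Polynomial.monom (Poly_Mapping.lookup p m) (w m))"
  have "poly P t = eval_at (\<lambda>i. t ^ (N ^ i)) p" for t
  proof -
    have "monom_at (\<lambda>i. t ^ (N ^ i)) m = t ^ w m" if "m \<in> ?K" for m
      using monom_at_superset[OF _ vars[OF that], of "\<lambda>i. t ^ (N ^ i)"]
      by (simp add: w_def power_sum mult.commute flip: power_mult)
    then show ?thesis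
      by (simp add: P_def poly_sum poly_monom eval_at_def coeff_hom.eval_hom_alt[OF coeff_hom_id])
  qed
  then have "P = 0"
    using assms poly_all_0_iff_0[of P] by simp
  have "Poly_Mapping.lookup p m = 0" if "m \<in> ?K" for m
  proof -
    have "0 = coeff P (w m)" by (simp add: \<open>P = 0\<close>)
    also have "\<dots> = (\<Sum>m'\<in>?K. if m' = m then Poly_Mapping.lookup p m' else 0)"
      unfolding P_def coeff_sum
      by (intro sum.cong) (use inj that in \<open>auto simp: inj_on_eq_iff\<close>)
    also have "\<dots> = Poly_Mapping.lookup p m"
      using that by simp
    finally show ?thesis by simp
  qed
  then show ?thesis
    by (intro poly_mapping_eqI) (auto simp: in_keys_iff)
qed

text \<open>A form p vanishes on the image exactly when \<open>subst F p\<close> vanishes wherever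
  the map is defined, hence everywhere. All later arguments use dominance in this shape.\<close>

lemma dominant_iff:
  "dominant n F \<longleftrightarrow> (\<forall>e. \<forall>p\<in>forms n e. subst F p = 0 \<longrightarrow> p = 0)"
proof
  assume "dominant n F"
  then show "\<forall>e. \<forall>p\<in>forms n e. subst F p = 0 \<longrightarrow> p = 0"
    by (fastforce simp: dominant_def map_at_def simp flip: eval_at_subst)
next
  assume inj: "\<forall>e. \<forall>p\<in>forms n e. subst F p = 0 \<longrightarrow> p = 0"
  \<comment> \<open>\<open>cvar 0\<close> is a nonzero form, and its pullback is
    \<open>F 0\<close>.\<close>
  then have "F 0 \<noteq> 0"
    using forms_cvar[of 0 n] by fastforce
  show "dominant n F"
    unfolding dominant_def
  proof (intro allI ballI impI)
    fix e p
    assume p: "p \<in> forms n e"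
      and van: "\<forall>x. proj_point n x \<and> proj_point n (map_at F x) \<longrightarrow> eval_at (map_at F x) p = 0"
    \<comment> \<open>The extra factors vanish where x_0 or F_0 does; elsewhere the point and its
      image are legitimate and \<open>van\<close> applies. So the product vanishes at every
      point.\<close>
    have "cvar 0 * F 0 * subst F p = 0"
    proof (rule eval_at_eq_0_imp_eq_0)
      fix x
      show "eval_at x (cvar 0 * F 0 * subst F p) = 0"
      proof (cases "x 0 = 0 \<or> eval_at x (F 0) = 0")
        case False
        then have "proj_point n x" "proj_point n (map_at F x)"
          by (auto simp: proj_point_def map_at_def)
        with van have "eval_at x (subst F p) = 0"
          by (simp add: map_at_def eval_at_subst)
        then show ?thesis by (simp add: eval_at_mult)
      qed (auto simp: eval_at_mult)
    qed
    with \<open>F 0 \<noteq> 0\<close> have "subst F p = 0" by simp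
    with inj p show "p = 0" by blast
  qed
qed

section \<open>Integer matrices without left kernel\<close>

text \<open>The determinant is a nonzero integer, and the integral adjugate is divided by it only
  inside the field. So a hypothesis on integer vectors yields an inverse over any field of
  characteristic zero.\<close>

lemma matrix_inverse_if_no_left_kernel:
  fixes A :: "nat \<Rightarrow> nat \<Rightarrow> int"
  assumes "\<And>c. \<forall>j\<le>n. (\<Sum>i\<le>n. c i * A i j) = 0 \<Longrightarrow> \<forall>i\<le>n. c i = 0"
  obtains B :: "nat \<Rightarrow> nat \<Rightarrow> 'a::field_char_0"
  where "\<forall>i\<le>n. \<forall>j\<le>n. (\<Sum>l\<le>n. of_int (A i l) * B l j) = (if i = j then 1 else 0)"
    and "\<forall>i\<le>n. \<forall>j\<le>n. (\<Sum>l\<le>n. B i l * of_int (A l j)) = (if i = j then 1 else 0)"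
proof -
  \<comment> \<open>Transposed, so that the left kernel of \<open>A\<close> becomes the kernel of
    \<open>M\<close>; the definition of \<open>B\<close> transposes back.\<close>
  define M where "M = mat (Suc n) (Suc n) (\<lambda>(i, j). A j i)"
  have M: "M \<in> carrier_mat (Suc n) (Suc n)" by (simp add: M_def)
  have le: "{..n} = {0..<Suc n}" by auto
  define D where "D = det M"
  have D: "D \<noteq> 0"
  proof
    assume "D = 0"
    then obtain v where v: "v \<in> carrier_vec (Suc n)" "v \<noteq> 0\<^sub>v (Suc n)" "M *\<^sub>v v = 0\<^sub>v (Suc n)"
      unfolding D_def det_0_iff_vec_prod_zero[OF M] by blast
    have "(\<Sum>i\<le>n. v $ i * A i j) = 0" if "j \<le> n" for j
    proof -
      have "0 = (M *\<^sub>v v) $ j" using v(3) that by simp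
      also have "\<dots> = (\<Sum>i\<le>n. v $ i * A i j)"
        using that v(1) by (simp add: M_def scalar_prod_def le mult.commute)
      finally show ?thesis by simp
    qed
    then have "\<forall>i\<le>n. v $ i = 0"
      using assms[of "\<lambda>i. v $ i"] by simp
    then have "v = 0\<^sub>v (Suc n)"
      using v(1) by (intro eq_vecI) auto
    with v(2) show False by simp
  qed
  define N where "N = adj_mat M"
  note adj = adj_mat[OF M, folded N_def D_def]
  define B where "B i j = (of_int (N $$ (j, i)) / of_int D :: 'a)" for i j
  have AB: "(\<Sum>l\<le>n. A i l * N $$ (j, l)) = (if i = j then D else 0)" if "i \<le> n" "j \<le> n" for i j
  proof -
    have "(N * M) $$ (j, i) = (\<Sum>l\<le>n. A i l * N $$ (j, l))"
      using that adj(1) by (simp add: M_def scalar_prod_def le mult.commute)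
    with adj(3) that show ?thesis by auto
  qed
  have BA: "(\<Sum>l\<le>n. N $$ (l, i) * A l j) = (if i = j then D else 0)" if "i \<le> n" "j \<le> n" for i j
  proof -
    have "(M * N) $$ (j, i) = (\<Sum>l\<le>n. N $$ (l, i) * A l j)"
      using that adj(1) by (simp add: M_def scalar_prod_def le mult.commute)
    with adj(2) that show ?thesis by auto
  qed
  show ?thesis
  proof (rule that[of B]; intro allI impI)
    fix i j assume "i \<le> n" "j \<le> n"
    have "(\<Sum>l\<le>n. of_int (A i l) * B l j) = of_int (\<Sum>l\<le>n. A i l * N $$ (j, l)) / of_int D"
      by (simp add: B_def sum_divide_distrib)
    with AB \<open>i \<le> n\<close> \<open>j \<le> n\<close> D show "(\<Sum>l\<le>n. of_int (A i l) * B l j) = (if i = j then 1 else 0)"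
      by simp
    have "(\<Sum>l\<le>n. B i l * of_int (A l j)) = of_int (\<Sum>l\<le>n. N $$ (l, i) * A l j) / of_int D"
      by (simp add: B_def sum_divide_distrib)
    with BA \<open>i \<le> n\<close> \<open>j \<le> n\<close> D show "(\<Sum>l\<le>n. B i l * of_int (A l j)) = (if i = j then 1 else 0)"
      by simp
  qed
qed

section \<open>Composites proportional to the identity\<close>

text \<open>The cross relations with index 0 read x_0 H_i = H_0 x_i, and homogeneity extracts the
  d-th power of the factor on each side.\<close>

lemma subst_same_as_cvar:
  assumes "same_rational_map n H cvar" "p \<in> forms n d"
  shows "cvar 0 ^ d * subst H p = H 0 ^ d * p"
proof -
  have "cvar 0 ^ d * subst H p = subst (\<lambda>i. cvar 0 * H i) p"
    using assms(2) by (simp add: subst_scale)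
  also have "\<dots> = subst (\<lambda>i. H 0 * cvar i) p"
    using assms by (intro subst_cong) (auto simp: same_rational_map_def mult.commute)
  also have "\<dots> = H 0 ^ d * p"
    using subst_scale[OF assms(2), of "H 0" cvar] by simp
  finally show ?thesis .
qed

lemma same_as_cvar_nonzero:
  assumes "same_rational_map n H cvar"
  shows "H 0 \<noteq> 0"
proof
  assume "H 0 = 0"
  with assms have "H i * cvar 0 = 0" if "i \<le> n" for i
    using that by (auto simp: same_rational_map_def)
  then have "\<forall>i\<le>n. H i = 0" by simp
  with assms show False unfolding same_rational_map_def rational_map_def by blast
qed

text \<open>Substituting first F and then G multiplies p by the nonzero fraction (H_0/x_0)^d, where
  H is the composite tuple; so substituting F cannot kill p.\<close>

lemma subst_right_inverse_inj:
  assumes "same_rational_map n (compose_map F G) cvar" "p \<in> forms n d" "subst F p = 0"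
  shows "p = 0"
proof -
  have "compose_map F G 0 ^ d * p = cvar 0 ^ d * subst G (subst F p)"
    using subst_same_as_cvar[OF assms(1,2)] by (simp add: subst_subst compose_map_def)
  with same_as_cvar_nonzero[OF assms(1)] assms(3) show ?thesis
    by simp
qed

lemma birational_subst_inj:
  assumes "birational n F" "p \<in> forms n d" "subst F p = 0"
  shows "p = 0"
  using assms subst_right_inverse_inj unfolding birational_def by blast

lemma forms_cvar_powers: "(\<Prod>i\<le>n. cvar i ^ a i) \<in> forms n (\<Sum>i\<le>n. a i)"
  by (intro forms_prod) (use forms_power[OF forms_cvar] in fastforce)

lemma subst_monomial_map_cvar_powers:
  "subst (monomial_map n A) (\<Prod>i\<le>n. cvar i ^ a i) = (\<Prod>j\<le>n. cvar j ^ (\<Sum>i\<le>n. A i j * a i))"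
proof -
  have "subst (monomial_map n A) (\<Prod>i\<le>n. cvar i ^ a i) = (\<Prod>i\<le>n. \<Prod>j\<le>n. cvar j ^ (A i j * a i))"
    by (simp add: subst_simps monomial_map_def power_mult flip: prod_power_distrib)
  also have "\<dots> = (\<Prod>j\<le>n. \<Prod>i\<le>n. cvar j ^ (A i j * a i))"
    by (rule prod.swap)
  finally show ?thesis by (simp add: power_sum)
qed

text \<open>Injectivity is known only on forms of one degree, so the monomials of the positive and
  negative part of c must first be shown to have equal degree. Adding up all exponents of their
  equal pullbacks gives k times either degree, and k is nonzero.\<close>

lemma birational_monomial_map_no_left_kernel:
  fixes c :: "nat \<Rightarrow> int"
  assumes "n \<ge> 1" and rows: "\<forall>i\<le>n. (\<Sum>j\<le>n. A i j) = k"
    and bir: "birational n (monomial_map n A)"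
    and ker: "\<forall>j\<le>n. (\<Sum>i\<le>n. c i * int (A i j)) = 0"
  shows "\<forall>i\<le>n. c i = 0"
proof -
  have inj: "(\<Prod>i\<le>n. cvar i ^ a i) = (\<Prod>i\<le>n. cvar i ^ b i)"
    if "\<forall>j\<le>n. (\<Sum>i\<le>n. A i j * a i) = (\<Sum>i\<le>n. A i j * b i)" "(\<Sum>i\<le>n. a i) = (\<Sum>i\<le>n. b i)"
    for a b :: "nat \<Rightarrow> nat"
  proof -
    let ?p = "(\<Prod>i\<le>n. cvar i ^ a i) - (\<Prod>i\<le>n. cvar i ^ b i)"
    have "?p \<in> forms n (\<Sum>i\<le>n. a i)"
      using forms_cvar_powers[of a n] forms_cvar_powers[of b n] that(2) by (auto intro: forms_diff)
    moreover have "subst (monomial_map n A) ?p = 0"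
      using that(1) by (simp add: subst_diff subst_monomial_map_cvar_powers)
    ultimately show ?thesis
      using birational_subst_inj[OF bir] by fastforce
  qed
  \<comment> \<open>For k = 0 the distinct variables x_0 and x_1, available since n >= 1, would both
    pull back to 1.\<close>
  have "k \<noteq> 0"
  proof
    assume "k = 0"
    with rows have "A i j = 0" if "i \<le> n" "j \<le> n" for i j
      using that by auto
    then have "(\<Prod>i\<le>n. cvar i ^ (if i = 0 then 1 else 0)) = (\<Prod>i\<le>n. cvar i ^ (if i = 1 then 1 else 0))"
      using assms(1) by (intro inj) auto
    from cvar_powers_inj[OF this, of 0] show False by simp
  qed
  define a where "a i = nat (c i)" for i
  define b where "b i = nat (- c i)" for i
  have c: "c i = int (a i) - int (b i)" for i
    by (simp add: a_def b_def)
  have col: "(\<Sum>i\<le>n. A i j * a i) = (\<Sum>i\<le>n. A i j * b i)" if "j \<le> n" for j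
  proof -
    have "int (\<Sum>i\<le>n. A i j * a i) - int (\<Sum>i\<le>n. A i j * b i) = (\<Sum>i\<le>n. c i * int (A i j))"
      by (simp add: c algebra_simps flip: sum_subtractf)
    with ker that have "int (\<Sum>i\<le>n. A i j * a i) = int (\<Sum>i\<le>n. A i j * b i)"
      by (simp del: of_nat_sum of_nat_mult)
    then show ?thesis by (simp only: of_nat_eq_iff)
  qed
  have total: "(\<Sum>j\<le>n. \<Sum>i\<le>n. A i j * d i) = k * (\<Sum>i\<le>n. d i)" for d
  proof -
    have "(\<Sum>j\<le>n. \<Sum>i\<le>n. A i j * d i) = (\<Sum>i\<le>n. \<Sum>j\<le>n. A i j * d i)"
      by (rule sum.swap)
    also have "\<dots> = (\<Sum>i\<le>n. k * d i)"
      using rows by (intro sum.cong) (auto simp flip: sum_distrib_right)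
    finally show ?thesis by (simp add: sum_distrib_left)
  qed
  have "k * (\<Sum>i\<le>n. a i) = k * (\<Sum>i\<le>n. b i)"
    using col by (simp flip: total)
  with \<open>k \<noteq> 0\<close> have "(\<Sum>i\<le>n. a i) = (\<Sum>i\<le>n. b i)" by simp
  with col have "(\<Prod>i\<le>n. cvar i ^ a i) = (\<Prod>i\<le>n. cvar i ^ b i)"
    by (intro inj) auto
  from cvar_powers_inj[OF this] show ?thesis
    by (simp add: c)
qed

section \<open>Function fields\<close>

text \<open>\<open>dimension\<close> is generated by line extensions; this form lets its induction
  run in ordinary field arithmetic.\<close>

lemma line_extension_type_algebra:
  fixes v :: "'a::field"
  shows "ring.line_extension ring_of_type_algebra P v E = {k * v + e |k e. k \<in> P \<and> e \<in> E}"
proof -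
  have "u \<in> ring.line_extension ring_of_type_algebra P v E \<longleftrightarrow> (\<exists>k\<in>P. \<exists>e\<in>E. u = k * v + e)" for u
    using ring.line_extension_mem_iff[OF ring_from_type_algebra, of u P v E]
    by (simp add: ring_of_type_algebra_def)
  then show ?thesis by blast
qed

lemma zero_in_dimension:
  fixes E :: "'a::field set"
  assumes "ring.dimension ring_of_type_algebra m P E" "0 \<in> P"
  shows "0 \<in> E"
  using assms
proof (induction m P E rule: ring.dimension.induct[OF ring_from_type_algebra, consumes 1, case_names 0 Suc])
  case (Suc v E n P)
  then have "0 = 0 * v + 0 \<and> 0 \<in> P \<and> 0 \<in> E" by simp
  then show ?case
    unfolding line_extension_type_algebra by blast
qed (simp add: ring_of_type_algebra_def)

text \<open>The chain of line extensions witnessing dimension m is mapped step by step, and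
  injectivity keeps each new generator outside the previous space. The base moves together with the
  space, so \<open>s\<close> is semilinear. Only 0 and 1 are asked of \<open>P\<close>, so pullback
  fields can enter as bare sets.\<close>

lemma dimension_image:
  fixes s :: "'a::field \<Rightarrow> 'b::field"
  assumes "\<And>x y. x \<in> K \<Longrightarrow> y \<in> K \<Longrightarrow> s (x + y) = s x + s y"
    and "\<And>x y. x \<in> K \<Longrightarrow> y \<in> K \<Longrightarrow> s (x * y) = s x * s y"
    and "\<And>x y. x \<in> K \<Longrightarrow> y \<in> K \<Longrightarrow> x * y \<in> K"
    and "inj_on s K"
    and "ring.dimension ring_of_type_algebra m P E" "0 \<in> P" "1 \<in> P" "P \<subseteq> K" "E \<subseteq> K"
  shows "ring.dimension ring_of_type_algebra m (s ` P) (s ` E)"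
  using assms(5-)
proof (induction m P E rule: ring.dimension.induct[OF ring_from_type_algebra, consumes 1, case_names 0 Suc])
  case (0 P)
  then have "0 \<in> K" by blast
  then have "s 0 = s 0 + s 0" using assms(1)[of 0 0] by simp
  then have "s 0 = 0" by (metis add_cancel_left_right)
  then show ?case
    using ring.zero_dim[OF ring_from_type_algebra, of "s ` P"]
    by (simp add: ring_of_type_algebra_def)
next
  case (Suc v E n P)
  have "0 \<in> E" using zero_in_dimension Suc by blast
  \<comment> \<open>The coefficient 1 here, and 0 further down, place the generator and the smaller
    space inside \<open>K\<close>, where the laws for \<open>s\<close> hold.\<close>
  then have "v = 1 * v + 0 \<and> 1 \<in> P \<and> 0 \<in> E" using Suc by simp
  with Suc.prems(4) have v: "v \<in> K"
    unfolding line_extension_type_algebra by blast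
  have E: "E \<subseteq> K"
  proof
    fix e assume "e \<in> E"
    then have "e = 0 * v + e \<and> 0 \<in> P \<and> e \<in> E" using Suc by simp
    with Suc.prems(4) show "e \<in> K"
      unfolding line_extension_type_algebra by blast
  qed
  have s: "s (k * v + e) = s k * s v + s e" if "k \<in> P" "e \<in> E" for k e
    using that v E Suc.prems(3) assms(1-3) by (simp add: subset_iff)
  have img: "s ` ring.line_extension ring_of_type_algebra P v E =
      ring.line_extension ring_of_type_algebra (s ` P) (s v) (s ` E)"
  proof -
    have "s ` {k * v + e |k e. k \<in> P \<and> e \<in> E} = {s (k * v + e) |k e. k \<in> P \<and> e \<in> E}"
      by blast
    also have "\<dots> = {s k * s v + s e |k e. k \<in> P \<and> e \<in> E}"
      using s by (intro Collect_cong) (auto, metis)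
    also have "\<dots> = {k * s v + e |k e. k \<in> s ` P \<and> e \<in> s ` E}"
      by blast
    finally show ?thesis by (simp only: line_extension_type_algebra)
  qed
  have "s v \<notin> s ` E"
    using Suc.hyps(2) v E assms(4) by (auto simp: inj_on_def)
  moreover have "ring.dimension ring_of_type_algebra n (s ` P) (s ` E)"
    using Suc E by blast
  ultimately show ?case
    unfolding img
    by (intro ring.Suc_dim[OF ring_from_type_algebra]) (simp_all add: ring_of_type_algebra_def)
qed

section \<open>Degree-zero fractions and their pullback\<close>

lemma function_fieldI: "p \<in> forms n d \<Longrightarrow> q \<in> forms n d \<Longrightarrow> q \<noteq> 0 \<Longrightarrow> Fract p q \<in> function_field n"
  unfolding function_field_def by blast

lemma function_fieldE:
  assumes "z \<in> function_field n"
  obtains p q d where "z = Fract p q" "p \<in> forms n d" "q \<in> forms n d" "q \<noteq> 0"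
  using assms unfolding function_field_def by blast

lemma function_field_add:
  assumes "x \<in> function_field n" "y \<in> function_field n"
  shows "x + y \<in> function_field n"
proof -
  obtain p q d p' q' d' where "x = Fract p q" "p \<in> forms n d" "q \<in> forms n d" "q \<noteq> 0"
      "y = Fract p' q'" "p' \<in> forms n d'" "q' \<in> forms n d'" "q' \<noteq> 0"
    using assms by (auto elim!: function_fieldE)
  then have "x + y = Fract (p * q' + p' * q) (q * q')" "q * q' \<noteq> 0"
      "p * q' + p' * q \<in> forms n (d + d')" "q * q' \<in> forms n (d + d')"
    by (simp_all add: forms_add forms_mult forms_mult')
  then show ?thesis
    by (simp add: function_fieldI)
qed

lemma function_field_mult:
  assumes "x \<in> function_field n" "y \<in> function_field n"
  shows "x * y \<in> function_field n"
proof -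
  obtain p q d p' q' d' where "x = Fract p q" "p \<in> forms n d" "q \<in> forms n d" "q \<noteq> 0"
      "y = Fract p' q'" "p' \<in> forms n d'" "q' \<in> forms n d'" "q' \<noteq> 0"
    using assms by (auto elim!: function_fieldE)
  then show ?thesis
    by (auto intro!: function_fieldI[of _ n "d + d'"] forms_mult)
qed

text \<open>Relevant only if \<open>subst F\<close> kills no nonzero form; then the value does not depend on
  the chosen representative of \<open>z\<close>.\<close>
definition pullback :: "nat \<Rightarrow> (nat \<Rightarrow> cpoly) \<Rightarrow> cpoly fract \<Rightarrow> cpoly fract"
  where "pullback n F z = (SOME w. \<exists>p q d. p \<in> forms n d \<and> q \<in> forms n d \<and> q \<noteq> 0
     \<and> z = Fract p q \<and> w = Fract (subst F p) (subst F q))"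

context
  fixes n :: nat and F :: "nat \<Rightarrow> cpoly"
  assumes dominant: "dominant n F"
begin

lemma subst_inj: "p \<in> forms n d \<Longrightarrow> subst F p = 0 \<Longrightarrow> p = 0"
  using dominant unfolding dominant_iff by blast

text \<open>Two representatives, possibly of different degrees, satisfy p q' = p' q. Substitution
  preserves this, and dominance keeps both denominators nonzero, so the choice made by
  \<open>SOME\<close> is harmless.\<close>

lemma pullback_Fract:
  assumes "p \<in> forms n d" "q \<in> forms n d" "q \<noteq> 0"
  shows "pullback n F (Fract p q) = Fract (subst F p) (subst F q)"
  unfolding pullback_def
proof (rule some_equality)
  fix w
  assume "\<exists>p' q' d'. p' \<in> forms n d' \<and> q' \<in> forms n d' \<and> q' \<noteq> 0
     \<and> Fract p q = Fract p' q' \<and> w = Fract (subst F p') (subst F q')"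
  then obtain p' q' d' where *: "p' \<in> forms n d'" "q' \<in> forms n d'" "q' \<noteq> 0"
     "Fract p q = Fract p' q'" "w = Fract (subst F p') (subst F q')"
    by blast
  then have "p * q' = p' * q"
    using assms by (simp add: eq_fract)
  then have "subst F p * subst F q' = subst F p' * subst F q"
    by (simp flip: subst_mult)
  moreover have "subst F q \<noteq> 0" "subst F q' \<noteq> 0"
    using subst_inj assms * by blast+
  ultimately show "w = Fract (subst F p) (subst F q)"
    by (simp add: * eq_fract)
qed (use assms in blast)

lemma pullback_add:
  assumes "x \<in> function_field n" "y \<in> function_field n"
  shows "pullback n F (x + y) = pullback n F x + pullback n F y"
proof -
  obtain p q d p' q' d' where *: "x = Fract p q" "p \<in> forms n d" "q \<in> forms n d" "q \<noteq> 0"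
      "y = Fract p' q'" "p' \<in> forms n d'" "q' \<in> forms n d'" "q' \<noteq> 0"
    using assms by (auto elim!: function_fieldE)
  have "pullback n F (Fract (p * q' + p' * q) (q * q')) =
      Fract (subst F (p * q' + p' * q)) (subst F (q * q'))"
    using * by (intro pullback_Fract[of _ "d + d'"]) (simp_all add: forms_add forms_mult forms_mult')
  moreover have "subst F q \<noteq> 0" "subst F q' \<noteq> 0"
    using subst_inj * by blast+
  ultimately show ?thesis
    using * by (simp add: pullback_Fract[of _ d] pullback_Fract[of _ d'] subst_add subst_mult)
qed

lemma pullback_mult:
  assumes "x \<in> function_field n" "y \<in> function_field n"
  shows "pullback n F (x * y) = pullback n F x * pullback n F y"
proof -
  obtain p q d p' q' d' where *: "x = Fract p q" "p \<in> forms n d" "q \<in> forms n d" "q \<noteq> 0"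
      "y = Fract p' q'" "p' \<in> forms n d'" "q' \<in> forms n d'" "q' \<noteq> 0"
    using assms by (auto elim!: function_fieldE)
  have "pullback n F (Fract (p * p') (q * q')) =
      Fract (subst F (p * p')) (subst F (q * q'))"
    using * by (intro pullback_Fract[of _ "d + d'"] forms_mult) auto
  then show ?thesis
    using * by (simp add: pullback_Fract[of _ d] pullback_Fract[of _ d'] subst_mult)
qed

text \<open>Equal pullbacks mean that the form p q' - p' q of degree d + d' is killed by
  \<open>subst F\<close>; dominance makes it zero.\<close>

lemma pullback_inj: "inj_on (pullback n F) (function_field n)"
proof
  fix x y
  assume "x \<in> function_field n" "y \<in> function_field n" and eq: "pullback n F x = pullback n F y"
  then obtain p q d p' q' d' where *: "x = Fract p q" "p \<in> forms n d" "q \<in> forms n d" "q \<noteq> 0"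
      "y = Fract p' q'" "p' \<in> forms n d'" "q' \<in> forms n d'" "q' \<noteq> 0"
    by (auto elim!: function_fieldE)
  moreover have "subst F q \<noteq> 0" "subst F q' \<noteq> 0"
    using subst_inj * by blast+
  ultimately have "subst F (p * q' - p' * q) = 0"
    using eq by (simp add: pullback_Fract[of _ d] pullback_Fract[of _ d'] eq_fract subst_mult subst_diff)
  moreover have "p * q' - p' * q \<in> forms n (d + d')"
    using * by (simp add: forms_diff forms_mult forms_mult')
  ultimately have "p * q' - p' * q = 0"
    using subst_inj by blast
  then show "x = y"
    using * by (simp add: eq_fract)
qed

lemma pullback_field_subset:
  assumes F_forms: "\<And>i. i \<le> n \<Longrightarrow> F i \<in> forms n e"
  shows "pullback_field n F \<subseteq> function_field n"
proof
  fix z assume "z \<in> pullback_field n F"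
  then obtain p q d where "z = Fract (subst F p) (subst F q)" "p \<in> forms n d" "q \<in> forms n d" "q \<noteq> 0"
    unfolding pullback_field_def by blast
  then show "z \<in> function_field n"
    using subst_inj F_forms by (auto intro!: function_fieldI[of _ n "e * d"] forms_subst)
qed

end

lemma pullback_field_0_1:
  "0 \<in> pullback_field n F" "1 \<in> pullback_field n F"
proof -
  have "Fract (subst F p) (subst F 1) \<in> pullback_field n F" if "p \<in> forms n 0" for p
    unfolding pullback_field_def
    by (rule CollectI, rule exI[of _ p], rule exI[of _ 1], rule exI[of _ 0]) (simp add: that)
  from this[of 0] this[of 1]
  show "0 \<in> pullback_field n F" "1 \<in> pullback_field n F"
    by (simp_all add: Zero_fract_def One_fract_def)
qed

section \<open>Invariance of the degree\<close>

text \<open>The chain rule for toric polar maps controls only indices up to n, so tuples are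
  compared there rather than as functions. The congruences below serve the same purpose.\<close>

lemma map_degree_cong:
  assumes "\<And>i. i \<le> n \<Longrightarrow> F i = G i"
  shows "map_degree n F = map_degree n G"
proof -
  have eq: "subst F p = subst G p" if "p \<in> forms n d" for p d
    using that assms by (rule subst_cong)
  then have "dominant n F = dominant n G"
    by (simp add: dominant_iff)
  moreover have "pullback_field n F = pullback_field n G"
    unfolding pullback_field_def
  proof (intro Collect_cong iff_exI)
    fix z p q d
    show "(z = Fract (subst F p) (subst F q) \<and> p \<in> forms n d \<and> q \<in> forms n d \<and> q \<noteq> 0) \<longleftrightarrow>
        (z = Fract (subst G p) (subst G q) \<and> p \<in> forms n d \<and> q \<in> forms n d \<and> q \<noteq> 0)"
      using eq[of p d] eq[of q d] by auto
  qed
  ultimately show ?thesis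
    by (simp add: map_degree_def)
qed

lemma rational_map_cong:
  assumes "\<And>i. i \<le> n \<Longrightarrow> F i = F' i"
  shows "rational_map n F \<longleftrightarrow> rational_map n F'"
  using assms by (simp add: rational_map_def cong: conj_cong)

lemma same_rational_map_cong:
  assumes "\<And>i. i \<le> n \<Longrightarrow> F i = F' i"
  shows "same_rational_map n F G \<longleftrightarrow> same_rational_map n F' G"
  using assms rational_map_cong[OF assms] by (simp add: same_rational_map_def)

lemma birational_cong:
  assumes "\<And>i. i \<le> n \<Longrightarrow> F i = F' i"
  shows "birational n F \<longleftrightarrow> birational n F'"
proof -
  have "same_rational_map n (compose_map G F) cvar \<longleftrightarrow> same_rational_map n (compose_map G F') cvar"
    if "rational_map n G" for G
  proof (rule same_rational_map_cong)
    fix i assume "i \<le> n"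
    with that obtain d where "G i \<in> forms n d"
      unfolding rational_map_def by blast
    then show "compose_map G F i = compose_map G F' i"
      unfolding compose_map_def using assms by (rule subst_cong)
  qed
  moreover have "same_rational_map n (compose_map F G) cvar \<longleftrightarrow> same_rational_map n (compose_map F' G) cvar" for G
    using assms by (intro same_rational_map_cong) (simp add: compose_map_def)
  moreover have "rational_map n F \<longleftrightarrow> rational_map n F'"
    using assms by (rule rational_map_cong)
  ultimately show ?thesis
    unfolding birational_def by blast
qed

text \<open>If G inverts F, then p/q is the pullback under F of p(G)/q(G): numerator and denominator
  acquire the same factor (H_0/x_0)^d, where H is the composite tuple.\<close>

lemma pullback_birational_surj:
  assumes "birational n F"
  shows "pullback n F ` function_field n = function_field n"
proof
  have dom: "dominant n F"
    using birational_subst_inj[OF assms] unfolding dominant_iff by blast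
  obtain e where e: "\<And>i. i \<le> n \<Longrightarrow> F i \<in> forms n e"
    using assms by (auto simp: birational_def rational_map_def)
  show "pullback n F ` function_field n \<subseteq> function_field n"
  proof (intro image_subsetI)
    fix z assume "z \<in> function_field n"
    then obtain p q d where *: "z = Fract p q" "p \<in> forms n d" "q \<in> forms n d" "q \<noteq> 0"
      by (rule function_fieldE)
    have "subst F q \<noteq> 0"
      using subst_inj[OF dom] *(3,4) by blast
    moreover have "subst F p \<in> forms n (e * d)" "subst F q \<in> forms n (e * d)"
      by (rule forms_subst[OF *(2)] forms_subst[OF *(3)], erule e)+
    ultimately show "pullback n F z \<in> function_field n"
      using pullback_Fract[OF dom *(2-4)] * by (simp add: function_fieldI)
  qed
  obtain G where G: "rational_map n G" "same_rational_map n (compose_map G F) cvar"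
    using assms unfolding birational_def by blast
  then obtain d' where d': "\<And>i. i \<le> n \<Longrightarrow> G i \<in> forms n d'"
    by (auto simp: rational_map_def)
  let ?H = "compose_map G F"
  have H: "subst F (subst G p) = subst ?H p" for p
    by (simp add: subst_subst compose_map_def)
  note H0 = same_as_cvar_nonzero[OF G(2)]
  show "function_field n \<subseteq> pullback n F ` function_field n"
  proof
    fix z assume "z \<in> function_field n"
    then obtain p q d where *: "z = Fract p q" "p \<in> forms n d" "q \<in> forms n d" "q \<noteq> 0"
      by (rule function_fieldE)
    note Hp = subst_same_as_cvar[OF G(2) *(2)] and Hq = subst_same_as_cvar[OF G(2) *(3)]
    have Hq0: "subst ?H q \<noteq> 0"
      using Hq H0 * by auto
    then have Gq: "subst G q \<noteq> 0"
      using H[of q] by auto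
    have Gf: "subst G p \<in> forms n (d' * d)" "subst G q \<in> forms n (d' * d)"
      by (rule forms_subst[OF *(2)] forms_subst[OF *(3)], erule d')+
    \<comment> \<open>Both products equal H_0^d p q, so x_0^d can be cancelled.\<close>
    have "cvar 0 ^ d * (subst ?H p * q) = (cvar 0 ^ d * subst ?H p) * q"
      by (simp only: mult.assoc)
    also have "\<dots> = p * (?H 0 ^ d * q)"
      unfolding Hp by (simp only: mult_ac)
    also have "\<dots> = cvar 0 ^ d * (p * subst ?H q)"
      unfolding Hq[symmetric] by (simp only: mult_ac)
    finally have "subst ?H p * q = p * subst ?H q" by simp
    then have "Fract (subst ?H p) (subst ?H q) = Fract p q"
      using Hq0 * by (simp add: eq_fract)
    then have "pullback n F (Fract (subst G p) (subst G q)) = z"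
      using pullback_Fract[OF dom Gf Gq] * by (simp add: H)
    then show "z \<in> pullback n F ` function_field n"
      using function_fieldI[OF Gf Gq] by blast
  qed
qed

text \<open>The automorphism given by F carries the field pulled back along G onto the one pulled
  back along the composite. Since \<open>ring.dim\<close> is read off from \<open>dimension\<close>,
  that predicate is shown equivalent for every m; this also covers the case where no m
  exists.\<close>

lemma map_degree_compose_birational:
  assumes F: "birational n F" and G: "\<And>i. i \<le> n \<Longrightarrow> G i \<in> forms n e"
  shows "map_degree n (compose_map G F) = map_degree n G"
proof -
  have domF: "dominant n F"
    using birational_subst_inj[OF F] unfolding dominant_iff by blast
  have comp: "subst (compose_map G F) p = subst F (subst G p)" for p
    by (simp add: subst_subst compose_map_def)
  have Gf: "subst G p \<in> forms n (e * d)" if "p \<in> forms n d" for p d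
    using that by (rule forms_subst) (rule G)
  have "subst F (subst G p) = 0 \<longleftrightarrow> subst G p = 0" if "p \<in> forms n d" for p d
    using subst_inj[OF domF Gf[OF that]] by auto
  then have dom: "dominant n (compose_map G F) \<longleftrightarrow> dominant n G"
    by (simp add: dominant_iff comp)
  have "ring.dimension ring_of_type_algebra m (pullback_field n (compose_map G F)) (function_field n)
     \<longleftrightarrow> ring.dimension ring_of_type_algebra m (pullback_field n G) (function_field n)" (is "?l \<longleftrightarrow> ?r")
    if domG: "dominant n G" for m
  proof -
    let ?K = "function_field n" and ?s = "pullback n F"
    \<comment> \<open>The inverse automorphism, because \<open>dimension_image\<close> gives one
      implication only.\<close>
    let ?t = "inv_into ?K ?s"
    let ?P = "pullback_field n G"
    have PK: "?P \<subseteq> ?K"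
      using domG G by (rule pullback_field_subset)
    have img: "?s ` ?P = pullback_field n (compose_map G F)"
    proof -
      have "?s (Fract (subst G p) (subst G q)) = Fract (subst (compose_map G F) p) (subst (compose_map G F) q)"
        if "p \<in> forms n d" "q \<in> forms n d" "q \<noteq> 0" for p q d
        unfolding comp
        using subst_inj[OF domG that(2)] that(3)
        by (intro pullback_Fract[OF domF Gf[OF that(1)] Gf[OF that(2)]]) auto
      note * = this
      show ?thesis
      proof
        show "?s ` ?P \<subseteq> pullback_field n (compose_map G F)"
        proof (intro image_subsetI)
          fix z assume "z \<in> ?P"
          then obtain p q d where "z = Fract (subst G p) (subst G q)"
              and pq: "p \<in> forms n d" "q \<in> forms n d" "q \<noteq> 0"
            unfolding pullback_field_def by blast
          with *[OF pq] show "?s z \<in> pullback_field n (compose_map G F)"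
            unfolding pullback_field_def by blast
        qed
        show "pullback_field n (compose_map G F) \<subseteq> ?s ` ?P"
        proof
          fix z assume "z \<in> pullback_field n (compose_map G F)"
          then obtain p q d where "z = Fract (subst (compose_map G F) p) (subst (compose_map G F) q)"
              and pq: "p \<in> forms n d" "q \<in> forms n d" "q \<noteq> 0"
            unfolding pullback_field_def by blast
          then have "z = ?s (Fract (subst G p) (subst G q))" "Fract (subst G p) (subst G q) \<in> ?P"
            using *[OF pq] unfolding pullback_field_def by auto
          then show "z \<in> ?s ` ?P" by blast
        qed
      qed
    qed
    note surj = pullback_birational_surj[OF F]
    note sinj = pullback_inj[OF domF]
    have t: "?t x \<in> ?K" "?s (?t x) = x" if "x \<in> ?K" for x
      using that surj by (simp_all add: inv_into_into f_inv_into_f)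
    have ts: "?t (?s x) = x" if "x \<in> ?K" for x
      using that sinj by simp
    have t_add: "?t (x + y) = ?t x + ?t y" if "x \<in> ?K" "y \<in> ?K" for x y
    proof -
      have "?s (?t x + ?t y) = x + y"
        using that t by (simp add: pullback_add[OF domF])
      then show ?thesis
        using ts[of "?t x + ?t y"] t that by (simp add: function_field_add)
    qed
    have t_mult: "?t (x * y) = ?t x * ?t y" if "x \<in> ?K" "y \<in> ?K" for x y
    proof -
      have "?s (?t x * ?t y) = x * y"
        using that t by (simp add: pullback_mult[OF domF])
      then show ?thesis
        using ts[of "?t x * ?t y"] t that by (simp add: function_field_mult)
    qed
    have t_inj: "inj_on ?t ?K"
      by (rule inj_on_inverseI) (rule t(2))
    have t_P: "?t ` ?s ` ?P = ?P"
    proof -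
      have "?t ` ?s ` ?P = (\<lambda>x. x) ` ?P"
        unfolding image_image using PK ts by (intro image_cong) auto
      then show ?thesis by simp
    qed
    have t_K: "?t ` ?K = ?K"
      using sinj surj by (intro bij_betw_imp_surj_on bij_betw_inv_into) (simp add: bij_betw_def)
    show ?thesis
    proof
      assume ?r
      then have "ring.dimension ring_of_type_algebra m (?s ` ?P) (?s ` ?K)"
        by (intro dimension_image[where K = ?K] pullback_field_0_1 PK order_refl sinj
            pullback_add[OF domF] pullback_mult[OF domF] function_field_mult)
      then show ?l by (simp add: img surj)
    next
      assume ?l
      moreover have "?s ` ?P \<subseteq> ?K" using PK surj by blast
      ultimately have "ring.dimension ring_of_type_algebra m (?t ` pullback_field n (compose_map G F)) (?t ` ?K)"
        by (intro dimension_image[where K = ?K] pullback_field_0_1 order_refl t_inj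
            t_add t_mult function_field_mult) (simp_all add: img)
      then show ?r by (simp add: t_P t_K flip: img)
    qed
  qed
  then have "ring.dim ring_of_type_algebra (pullback_field n (compose_map G F)) (function_field n)
     = ring.dim ring_of_type_algebra (pullback_field n G) (function_field n)" if "dominant n G"
    using that by (simp add: ring.dim_def[OF ring_from_type_algebra])
  then show ?thesis
    by (simp add: map_degree_def dom)
qed

section \<open>Linear changes of coordinates on the target\<close>

text \<open>Entry j takes its coefficients from column j, so the matrix A gives the map of its
  transpose, as in the chain rule.\<close>

definition linear_forms :: "nat \<Rightarrow> (nat \<Rightarrow> nat \<Rightarrow> complex) \<Rightarrow> nat \<Rightarrow> cpoly"
  where "linear_forms n M j = (\<Sum>i\<le>n. cconst (M i j) * cvar i)"

lemma forms_linear_forms: "linear_forms n M j \<in> forms n 1"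
  unfolding linear_forms_def
  by (intro forms_sum) (use forms_mult[OF forms_cconst forms_cvar] in fastforce)

lemma subst_linear_forms: "subst F (linear_forms n M j) = (\<Sum>i\<le>n. cconst (M i j) * F i)"
  by (simp add: linear_forms_def subst_simps)

lemma subst_linear_forms_inverse:
  assumes inv: "\<forall>i\<le>n. \<forall>j\<le>n. (\<Sum>l\<le>n. M i l * N l j) = (if i = j then 1 else 0)"
    and "p \<in> forms n d"
  shows "subst (linear_forms n M) (subst (linear_forms n N) p) = p"
proof -
  have "subst (linear_forms n M) (linear_forms n N j) = cvar j" if "j \<le> n" for j
  proof -
    have "subst (linear_forms n M) (linear_forms n N j)
        = (\<Sum>l\<le>n. \<Sum>i\<le>n. cconst (M i l * N l j) * cvar i)"
      unfolding subst_linear_forms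
      by (simp add: linear_forms_def sum_distrib_left cconst_mult mult_ac)
    also have "\<dots> = (\<Sum>i\<le>n. \<Sum>l\<le>n. cconst (M i l * N l j) * cvar i)"
      by (rule sum.swap)
    also have "\<dots> = (\<Sum>i\<le>n. if i = j then cvar i else 0)"
      using inv that by (intro sum.cong) (simp_all flip: sum_distrib_right cconst_sum)
    also have "\<dots> = cvar j"
      using that by simp
    finally show ?thesis .
  qed
  then have "subst (\<lambda>j. subst (linear_forms n M) (linear_forms n N j)) p = subst cvar p"
    by (intro subst_cong[OF assms(2)])
  then show ?thesis by (simp add: subst_subst)
qed

context
  fixes n :: nat and M N :: "nat \<Rightarrow> nat \<Rightarrow> complex"
  assumes MN: "\<forall>i\<le>n. \<forall>j\<le>n. (\<Sum>l\<le>n. M i l * N l j) = (if i = j then 1 else 0)"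
    and NM: "\<forall>i\<le>n. \<forall>j\<le>n. (\<Sum>l\<le>n. N i l * M l j) = (if i = j then 1 else 0)"
begin

text \<open>Substituting an invertible family of linear forms permutes the nonzero forms of each
  degree. Hence the same fractions get pulled back along F, only indexed differently.\<close>

lemma map_degree_linear_compose:
  "map_degree n (compose_map (linear_forms n M) F) = map_degree n F"
proof -
  let ?M = "subst (linear_forms n M)" and ?N = "subst (linear_forms n N)"
  have comp: "subst (compose_map (linear_forms n M) F) p = subst F (?M p)" for p
    by (simp add: subst_subst compose_map_def)
  have M: "?M p \<in> forms n d" and N: "?N p \<in> forms n d" if "p \<in> forms n d" for p d
    using forms_subst[OF that forms_linear_forms] by simp_all
  have MN': "?M (?N p) = p" and NM': "?N (?M p) = p" if "p \<in> forms n d" for p d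
    using subst_linear_forms_inverse[OF MN that] subst_linear_forms_inverse[OF NM that] by simp_all
  have M0: "?M p = 0 \<longleftrightarrow> p = 0" and N0: "?N p = 0 \<longleftrightarrow> p = 0" if "p \<in> forms n d" for p d
    using MN'[OF that] NM'[OF that] by (metis subst_0)+
  have "dominant n (compose_map (linear_forms n M) F) \<longleftrightarrow> dominant n F"
  proof
    assume dom: "dominant n F"
    show "dominant n (compose_map (linear_forms n M) F)"
      unfolding dominant_iff comp
    proof (intro allI ballI impI)
      fix d p assume p: "p \<in> forms n d" "subst F (?M p) = 0"
      with dom M have "?M p = 0" unfolding dominant_iff by blast
      with M0 p show "p = 0" by blast
    qed
  next
    assume dom: "dominant n (compose_map (linear_forms n M) F)"
    show "dominant n F"
      unfolding dominant_iff
    proof (intro allI ballI impI)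
      fix d p assume p: "p \<in> forms n d" "subst F p = 0"
      \<comment> \<open>Writing p as the \<open>?M\<close>-image of \<open>?N p\<close> brings the
        dominance of the composite to bear.\<close>
      with MN' have "subst F (?M (?N p)) = 0" by simp
      with dom N p have "?N p = 0" unfolding dominant_iff comp by blast
      with N0 p show "p = 0" by blast
    qed
  qed
  moreover have "pullback_field n (compose_map (linear_forms n M) F) = pullback_field n F"
  proof
    show "pullback_field n (compose_map (linear_forms n M) F) \<subseteq> pullback_field n F"
      unfolding pullback_field_def comp using M M0 by blast
    show "pullback_field n F \<subseteq> pullback_field n (compose_map (linear_forms n M) F)"
    proof
      fix z assume "z \<in> pullback_field n F"
      then obtain p q d where *: "z = Fract (subst F p) (subst F q)" "p \<in> forms n d" "q \<in> forms n d" "q \<noteq> 0"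
        unfolding pullback_field_def by blast
      then have "z = Fract (subst F (?M (?N p))) (subst F (?M (?N q)))"
          "?N p \<in> forms n d" "?N q \<in> forms n d" "?N q \<noteq> 0"
        using MN' N N0 by simp_all
      then show "z \<in> pullback_field n (compose_map (linear_forms n M) F)"
        unfolding pullback_field_def comp by blast
    qed
  qed
  ultimately show ?thesis
    by (simp add: map_degree_def)
qed

lemma birational_linear_compose:
  assumes "birational n F"
  shows "birational n (compose_map (linear_forms n M) F)"
proof -
  let ?M = "subst (linear_forms n M)" and ?N = "subst (linear_forms n N)"
  let ?F = "compose_map (linear_forms n M) F"
  have MN': "?M (?N p) = p" and NM': "?N (?M p) = p" if "p \<in> forms n d" for p d
    using subst_linear_forms_inverse[OF MN that] subst_linear_forms_inverse[OF NM that] by simp_all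
  have N0: "?N p \<noteq> 0" if "p \<in> forms n d" "p \<noteq> 0" for p d
    using MN'[OF that(1)] that(2) by (metis subst_0)
  have comp: "subst ?F p = subst F (?M p)" for p
    by (simp add: subst_subst compose_map_def)
  obtain G where G: "rational_map n G" "same_rational_map n (compose_map G F) cvar"
      "same_rational_map n (compose_map F G) cvar" and F: "rational_map n F"
    using assms unfolding birational_def by blast
  obtain d where d: "\<And>i. i \<le> n \<Longrightarrow> F i \<in> forms n d"
    using F by (auto simp: rational_map_def)
  obtain e where e: "\<And>i. i \<le> n \<Longrightarrow> G i \<in> forms n e"
    using G by (auto simp: rational_map_def)
  \<comment> \<open>The inverse of a linear map L after F is G after the inverse of L, that is, G
    with the linear forms of \<open>N\<close> substituted.\<close>
  define G' where "G' i = ?N (G i)" for i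
  have F': "?F j \<in> forms n d" for j
    using forms_subst[OF forms_linear_forms, of n F d M] d by (simp add: compose_map_def)
  have G': "G' i \<in> forms n e" if "i \<le> n" for i
    using forms_subst[OF e[OF that] forms_linear_forms] by (simp add: G'_def)
  \<comment> \<open>If the matrix killed the tuple F, applying the inverse matrix would show F
    itself to be zero.\<close>
  have "\<exists>j\<le>n. ?F j \<noteq> 0"
  proof (rule ccontr)
    assume "\<not> ?thesis"
    then have "subst ?F (linear_forms n N i) = 0" for i
      by (simp add: subst_linear_forms)
    moreover have "?M (linear_forms n N i) = cvar i" if "i \<le> n" for i
      using MN'[OF forms_cvar[OF that]] by simp
    ultimately have "F i = 0" if "i \<le> n" for i
      using that comp by (metis subst_var)
    with F show False by (auto simp: rational_map_def)
  qed
  then have rF: "rational_map n ?F"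
    using F' by (auto simp: rational_map_def)
  have rG: "rational_map n G'"
    using G(1) G' N0[OF e] by (auto simp: rational_map_def G'_def)
  have "same_rational_map n (compose_map G' ?F) cvar"
    using G(2) MN'[OF e] same_rational_map_cong[of n "compose_map G' ?F" "compose_map G F" cvar]
    by (simp add: compose_map_def[of G'] compose_map_def[of G] comp G'_def)
  moreover have "same_rational_map n (compose_map ?F G') cvar"
  proof -
    let ?H = "compose_map F G" and ?C = "compose_map ?F G'"
    have subst_G': "subst G' p = ?N (subst G p)" for p
      by (simp add: subst_subst G'_def[abs_def])
    \<comment> \<open>In this order the near-identity F after G sits between the two linear maps.
      Its proportionality relation is applied to the forms of \<open>M\<close> and then pushed
      through \<open>?N\<close>, which changes the two factors but keeps them nonzero.\<close>
    have "cvar 0 * subst ?H (linear_forms n M j) = ?H 0 * linear_forms n M j" for j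
      using subst_same_as_cvar[OF G(3) forms_linear_forms] by simp
    then have "cvar 0 * subst G (subst F (linear_forms n M j)) = ?H 0 * linear_forms n M j" for j
      by (simp add: subst_subst compose_map_def)
    from this[THEN arg_cong[of _ _ ?N]]
    have "linear_forms n N 0 * ?C j = ?N (?H 0) * ?N (linear_forms n M j)" for j
      by (simp add: subst_mult compose_map_def[of _ G'] subst_G') (simp add: compose_map_def)
    moreover have "?N (linear_forms n M j) = cvar j" if "j \<le> n" for j
      using NM'[OF forms_cvar[OF that]] by simp
    ultimately have C: "linear_forms n N 0 * ?C j = ?N (?H 0) * cvar j" if "j \<le> n" for j
      using that by simp
    have N00: "linear_forms n N 0 \<noteq> 0"
      using N0[OF forms_cvar[of 0 n]] by simp
    have "linear_forms n N 0 * (?C i * cvar j) = linear_forms n N 0 * (?C j * cvar i)"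
      if "i \<le> n" "j \<le> n" for i j
    proof -
      have "linear_forms n N 0 * (?C i * cvar j) = ?N (?H 0) * cvar i * cvar j"
        by (simp only: C[OF that(1)] flip: mult.assoc)
      also have "\<dots> = linear_forms n N 0 * ?C j * cvar i"
        unfolding C[OF that(2)] by (simp only: mult_ac)
      finally show ?thesis by (simp only: mult.assoc)
    qed
    with N00 have cross: "\<forall>i\<le>n. \<forall>j\<le>n. ?C i * cvar j = ?C j * cvar i"
      by simp
    have "?H 0 \<in> forms n (e * d)"
      unfolding compose_map_def by (rule forms_subst[OF d]) (simp_all add: e)
    then have "?N (?H 0) \<noteq> 0"
      using N0 same_as_cvar_nonzero[OF G(3)] by blast
    then have "?C 0 \<noteq> 0"
      using C[of 0] by auto
    moreover have "?C j \<in> forms n (e * d)" for j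
      unfolding compose_map_def[of _ G'] by (rule forms_subst[OF F']) (rule G')
    ultimately have "rational_map n ?C"
      unfolding rational_map_def by blast
    with cross G(3) show ?thesis
      by (simp add: same_rational_map_def)
  qed
  ultimately show ?thesis
    using rF rG unfolding birational_def by blast
qed

end

lemma toric_polar_sum: "toric_polar (sum F S) j = (\<Sum>i\<in>S. toric_polar (F i) j)"
  by (induction S rule: infinite_finite_induct) (simp_all add: toric_polar_add)

theorem proposition4p11:
  fixes n k :: nat and A :: "nat \<Rightarrow> nat \<Rightarrow> nat"
  assumes "n \<ge> 1"
    and "\<forall>i\<le>n. (\<Sum>j\<le>n. A i j) = k"
    and "\<forall>p. (\<forall>i\<le>n. p dvd monomial_map n A i) \<longrightarrow> p dvd 1"
    and "birational n (monomial_map n A)"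
  shows "(\<forall>d\<ge>1. \<forall>f\<in>forms n d. f \<noteq> 0 \<longrightarrow>
            map_degree n (toric_polar (subst (monomial_map n A) f)) = map_degree n (toric_polar f))
       \<and> subst (monomial_map n A) (\<Sum>i\<le>n. cvar i) = (\<Sum>i\<le>n. monomial_map n A i)
       \<and> birational n (toric_polar (subst (monomial_map n A) (\<Sum>i\<le>n. cvar i)))"
proof -
  let ?\<phi> = "monomial_map n A"
  define M where "M i j = (of_nat (A i j) :: complex)" for i j
  let ?L = "linear_forms n M"
  have ker: "\<forall>i\<le>n. c i = 0" if "\<forall>j\<le>n. (\<Sum>i\<le>n. c i * int (A i j)) = 0" for c
    using assms(1,2,4) that by (rule birational_monomial_map_no_left_kernel)
  obtain N :: "nat \<Rightarrow> nat \<Rightarrow> complex" where N: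
    "\<forall>i\<le>n. \<forall>j\<le>n. (\<Sum>l\<le>n. of_int (int (A i l)) * N l j) = (if i = j then 1 else 0)"
    "\<forall>i\<le>n. \<forall>j\<le>n. (\<Sum>l\<le>n. N i l * of_int (int (A l j))) = (if i = j then 1 else 0)"
    by (rule matrix_inverse_if_no_left_kernel) (rule ker)
  note MN = N(1)[unfolded of_int_of_nat_eq, folded M_def]
    and NM = N(2)[unfolded of_int_of_nat_eq, folded M_def]
  have chain: "toric_polar (subst ?\<phi> f) j = compose_map ?L (compose_map (toric_polar f) ?\<phi>) j"
    if "f \<in> forms n d" "j \<le> n" for f d j
    using toric_polar_subst_monomial_map[OF that, of A]
    by (simp add: compose_map_def subst_linear_forms M_def cconst_of_nat)
  have "map_degree n (toric_polar (subst ?\<phi> f)) = map_degree n (toric_polar f)" if "f \<in> forms n d" for f d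
  proof -
    have "map_degree n (toric_polar (subst ?\<phi> f)) =
        map_degree n (compose_map ?L (compose_map (toric_polar f) ?\<phi>))"
      using chain[OF that] by (rule map_degree_cong)
    also have "\<dots> = map_degree n (compose_map (toric_polar f) ?\<phi>)"
      by (rule map_degree_linear_compose[OF MN NM])
    also have "\<dots> = map_degree n (toric_polar f)"
      using assms(4) forms_toric_polar[OF that] by (rule map_degree_compose_birational)
    finally show ?thesis .
  qed
  moreover have "subst ?\<phi> (\<Sum>i\<le>n. cvar i) = (\<Sum>i\<le>n. ?\<phi> i)"
    by (simp add: subst_sum)
  \<comment> \<open>An inverse is constructed directly, from the one of the monomial map and the
    inverse matrix, rather than inferred from degree 1.\<close>
  moreover have "birational n (toric_polar (subst ?\<phi> (\<Sum>i\<le>n. cvar i)))"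
  proof -
    let ?f = "\<Sum>i\<le>n. cvar i"
    have f: "?f \<in> forms n 1" by (rule forms_sum, rule forms_cvar) simp
    have "toric_polar ?f i = cvar i" if "i \<le> n" for i
      using that by (simp add: toric_polar_sum toric_polar_cvar)
    then have "compose_map ?L (compose_map (toric_polar ?f) ?\<phi>) j = compose_map ?L ?\<phi> j" for j
      by (simp add: compose_map_def subst_linear_forms)
    with chain[OF f] have "toric_polar (subst ?\<phi> ?f) j = compose_map ?L ?\<phi> j" if "j \<le> n" for j
      using that by simp
    then show ?thesis
      using birational_linear_compose[OF MN NM assms(4)] birational_cong[of n _ "compose_map ?L ?\<phi>"]
      by blast
  qed
  ultimately show ?thesis by blast
qed

end
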